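(* Let $n\ge 2$, $m\ge 2$, $N=\{1,\dots,n\}$, and let $\mathcal{A}=(a_{i_1\cdots i_m})\in\mathbb{R}^{[m,n]}$ be a weakly symmetric nonnegative tensor. Then $$\varrho(\mathcal{A})\le \Omega_{max}(\mathcal{A}):=\max\big\{\hat{\Omega}_{max}(\mathcal{A}),\tilde{\Omega}_{max}(\mathcal{A})\big\},$$ where $$\hat{\Omega}_{max}(\mathcal{A})=\max_{i\in N}\min_{j\in N,\, j\neq i}\min\big\{r_i^{\overline{\Delta}_j}(\mathcal{A}),\,r_j^{\Delta_j}(\mathcal{A})\big\},$$ $$\tilde{\Omega}_{max}(\mathcal{A})=\max_{i\in N}\min_{j\in N,\, j\neq i}\min\left\{R_i(\mathcal{A}),\,\bar{\Omega}_{i,j}(\mathcal{A})\right\},$$ and $$\bar{\Omega}_{i,j}(\mathcal{A})=\frac12\left\{r_i^{\overline{\Delta}_j}(\mathcal{A})+r_j^{\Delta_j}(\mathcal{A})+\sqrt{\big(r_i^{\overline{\Delta}_j}(\mathcal{A})-r_j^{\Delta_j}(\mathcal{A})\big)^2+4\,r_i^{\Delta_j}(\mathcal{A})\,r_j^{\overline{\Delta}_j}(\mathcal{A})}\right\}.$$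
   Context: $\mathbb{R}^{[m,n]}$ denotes the set of real tensors of order $m$ and dimension $n$, i.e. arrays $\mathcal{A}=(a_{i_1i_2\cdots i_m})$ with $a_{i_1\cdots i_m}\in\mathbb{R}$ for all $i_1,\dots,i_m\in N=\{1,\dots,n\}$. $\mathcal{A}$ is nonnegative if all its entries are $\ge 0$. For a vector $x=(x_1,\dots,x_n)^T$, $\mathcal{A}x^{m-1}$ is the $n$-dimensional vector with $i$th component $$(\mathcal{A}x^{m-1})_i=\sum_{i_2,\dots,i_m\in N}a_{ii_2\cdots i_m}x_{i_2}\cdots x_{i_m},$$ and $\mathcal{A}x^m=\sum_{i_1,\dots,i_m\in N}a_{i_1\cdots i_m}x_{i_1}\cdots x_{i_m}$. $\mathcal{A}$ is weakly symmetric if the homogeneous polynomial $\mathcal{A}x^m$ satisfies $\nabla \mathcal{A}x^m=m\mathcal{A}x^{m-1}$. A real number $\lambda$ is a $Z$-eigenvalue of $\mathcal{A}$ if there is a real vector $x\in\mathbb{R}^n\setminus\{0\}$ with $\mathcal{A}x^{m-1}=\lambda x$ and $x^Tx=1$. The $Z$-spectrum $\sigma(\mathcal{A})$ is the set of all $Z$-eigenvalues of $\mathcal{A}$, and (when $\sigma(\mathcal{A})\ne\emptyset$) the $Z$-spectral radius is $\varrho(\mathcal{A})=\sup\{|\lambda|:\lambda\in\sigma(\mathcal{A})\}$. For $i,j\in N$, $$R_i(\mathcal{A})=\sum_{i_2,\dots,i_m\in N}|a_{ii_2\cdots i_m}|,\qquad r_i^{\Delta_j}(\mathcal{A})=\sum_{j\in\{i_2,\dots,i_m\}}|a_{ii_2\cdots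 i_m}|,\qquad r_i^{\overline{\Delta}_j}(\mathcal{A})=\sum_{j\notin\{i_2,\dots,i_m\}}|a_{ii_2\cdots i_m}|,$$ where the last two sums run over all tuples $(i_2,\dots,i_m)\in N^{m-1}$ such that $j$ does, respectively does not, occur among $i_2,\dots,i_m$ (in particular $r_j^{\Delta_j}$ and $r_j^{\overline{\Delta}_j}$ are these quantities with first index equal to $j$). *)

theory Defs
  imports "HOL-Analysis.Analysis"
begin

text \<open>
  A tensor of order \<open>m\<close> and dimension \<open>n = CARD('n)\<close> is a function on index lists over \<open>'n\<close>, where
  only the values at lists of length \<open>m\<close> are relevant. The order is not part of the type, so it
  is an explicit argument \<open>m\<close> of every notion below.
\<close>

type_synonym 'n tensor = "'n list \<Rightarrow> real"

definition index_tuples :: "nat \<Rightarrow> 'n list set" where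
  "index_tuples k = {js. length js = k}"

definition nonneg_tensor :: "nat \<Rightarrow> 'n tensor \<Rightarrow> bool" where
  "nonneg_tensor m A \<longleftrightarrow> (\<forall>js\<in>index_tuples m. A js \<ge> 0)"

text \<open>The vector \<open>A x\<^sup>m\<^sup>-\<^sup>1\<close> and the homogeneous polynomial \<open>A x\<^sup>m\<close>.\<close>

definition tensor_apply :: "nat \<Rightarrow> 'n::finite tensor \<Rightarrow> real ^ 'n \<Rightarrow> real ^ 'n" where
  "tensor_apply m A x =
     (\<chi> i. \<Sum>js\<in>index_tuples (m - 1). A (i # js) * (\<Prod>j\<leftarrow>js. x $ j))"

definition tensor_form :: "nat \<Rightarrow> 'n::finite tensor \<Rightarrow> real ^ 'n \<Rightarrow> real" where
  "tensor_form m A x = (\<Sum>js\<in>index_tuples m. A js * (\<Prod>j\<leftarrow>js. x $ j))"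

definition weakly_symmetric :: "nat \<Rightarrow> 'n::finite tensor \<Rightarrow> bool" where
  "weakly_symmetric m A \<longleftrightarrow>
     (\<forall>x. GDERIV (tensor_form m A) x :> real m *\<^sub>R tensor_apply m A x)"

definition Z_eigenvalue :: "nat \<Rightarrow> 'n::finite tensor \<Rightarrow> real \<Rightarrow> bool" where
  "Z_eigenvalue m A \<mu> \<longleftrightarrow> (\<exists>x. x \<noteq> 0 \<and> tensor_apply m A x = \<mu> *\<^sub>R x \<and> x \<bullet> x = 1)"

definition Z_spectrum :: "nat \<Rightarrow> 'n::finite tensor \<Rightarrow> real set" where
  "Z_spectrum m A = {\<mu>. Z_eigenvalue m A \<mu>}"

text \<open>
  The supremum is that of the reals, hence meaningful only for a nonempty bounded spectrum. The
  spectrum is always bounded, and it is nonempty for weakly symmetric tensors of positive order (a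
  maximizer of \<open>A x\<^sup>m\<close> on the unit sphere is an eigenvector).
\<close>

definition Z_spectral_radius :: "nat \<Rightarrow> 'n::finite tensor \<Rightarrow> real" where
  "Z_spectral_radius m A = (SUP \<mu>\<in>Z_spectrum m A. \<bar>\<mu>\<bar>)"

definition row_sum :: "nat \<Rightarrow> 'n::finite tensor \<Rightarrow> 'n \<Rightarrow> real" where
  "row_sum m A i = (\<Sum>js\<in>index_tuples (m - 1). \<bar>A (i # js)\<bar>)"

text \<open>
  \<open>row_sum_in m A i j\<close> and \<open>row_sum_out m A i j\<close> are the sums of \<open>\<bar>a\<bar>\<close> with first index \<open>i\<close> over the
  remaining tuples in which \<open>j\<close> does, respectively does not, occur.
\<close>

definition row_sum_in :: "nat \<Rightarrow> 'n::finite tensor \<Rightarrow> 'n \<Rightarrow> 'n \<Rightarrow> real" where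
  "row_sum_in m A i j = (\<Sum>js\<in>{js \<in> index_tuples (m - 1). j \<in> set js}. \<bar>A (i # js)\<bar>)"

definition row_sum_out :: "nat \<Rightarrow> 'n::finite tensor \<Rightarrow> 'n \<Rightarrow> 'n \<Rightarrow> real" where
  "row_sum_out m A i j = (\<Sum>js\<in>{js \<in> index_tuples (m - 1). j \<notin> set js}. \<bar>A (i # js)\<bar>)"

definition Omega_bar :: "nat \<Rightarrow> 'n::finite tensor \<Rightarrow> 'n \<Rightarrow> 'n \<Rightarrow> real" where
  "Omega_bar m A i j =
     1 / 2 * (row_sum_out m A i j + row_sum_in m A j j
       + sqrt ((row_sum_out m A i j - row_sum_in m A j j)\<^sup>2
               + 4 * row_sum_in m A i j * row_sum_out m A j j))"

text \<open>The inner minima below range over a nonempty set only if \<open>CARD('n) \<ge> 2\<close>.\<close>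

definition Omega_hat_max :: "nat \<Rightarrow> 'n::finite tensor \<Rightarrow> real" where
  "Omega_hat_max m A =
     (MAX i\<in>UNIV. MIN j\<in>UNIV - {i}. min (row_sum_out m A i j) (row_sum_in m A j j))"

definition Omega_tilde_max :: "nat \<Rightarrow> 'n::finite tensor \<Rightarrow> real" where
  "Omega_tilde_max m A =
     (MAX i\<in>UNIV. MIN j\<in>UNIV - {i}. min (row_sum m A i) (Omega_bar m A i j))"

definition Omega_max :: "nat \<Rightarrow> 'n::finite tensor \<Rightarrow> real" where
  "Omega_max m A = max (Omega_hat_max m A) (Omega_tilde_max m A)"

end

theory Submission
  imports Defs
begin

text \<open>
  A maximizer \<open>y \<ge> 0\<close> of \<open>A x\<^sup>m\<close> on the unit sphere is an eigenvector whose eigenvalue \<open>\<rho>\<close>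
  dominates the whole spectrum in absolute value, because \<open>\<bar>A x\<^sup>m\<bar> \<le> A \<bar>x\<bar>\<^sup>m\<close>. Let \<open>y\<^sub>t\<close> be its
  largest entry. As all entries are at most \<open>1\<close>, the eigenvalue equations at \<open>t\<close> and at \<open>j \<noteq> t\<close> give
  a nonnegative 2-by-2 system for \<open>(y\<^sub>t, y\<^sub>j)\<close>, whose Perron root is \<open>Omega_bar m A t j\<close>; hence
  already \<open>Omega_tilde_max\<close> bounds \<open>\<rho>\<close>.
\<close>

section \<open>Index tuples and elementary properties of the form\<close>

lemma finite_index_tuples [simp]: "finite (index_tuples k :: 'n::finite list set)"
  using finite_lists_length_eq[of "UNIV :: 'n set" k] by (simp add: index_tuples_def)

lemma sum_index_tuples_Suc:
  fixes g :: "'n::finite list \<Rightarrow> 'b::comm_monoid_add"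
  shows "sum g (index_tuples (Suc k)) = (\<Sum>i\<in>UNIV. \<Sum>js\<in>index_tuples k. g (i # js))"
proof -
  have "bij_betw (\<lambda>(i, js). i # js) (UNIV \<times> index_tuples k) (index_tuples (Suc k) :: 'n list set)"
    by (auto simp: bij_betw_def inj_on_def index_tuples_def length_Suc_conv image_iff)
  from sum.reindex_bij_betw[OF this, of g] show ?thesis
    by (simp add: sum.cartesian_product case_prod_unfold)
qed

text \<open>Identifies the eigenvalue of a unit eigenvector with the value of the form
  there.\<close>

lemma inner_tensor_apply:
  assumes "m > 0"
  shows "x \<bullet> tensor_apply m A x = tensor_form m A x"
proof -
  obtain k where "m = Suc k" using assms gr0_conv_Suc by auto
  then show ?thesis
    by (simp add: tensor_form_def tensor_apply_def sum_index_tuples_Suc inner_vec_def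
        sum_distrib_left mult_ac)
qed

lemma tensor_form_scaleR: "tensor_form m A (c *\<^sub>R x) = c ^ m * tensor_form m A x"
proof -
  have *: "(\<Prod>j\<leftarrow>js. (c *\<^sub>R x) $ j) = c ^ length js * (\<Prod>j\<leftarrow>js. x $ j)" for js
    by (induction js) auto
  show ?thesis unfolding tensor_form_def sum_distrib_left *
    by (rule sum.cong) (auto simp: index_tuples_def)
qed

text \<open>The triangle inequality, applied monomial by monomial. It makes a maximizer nonnegative
  and also controls negative eigenvalues.\<close>

lemma abs_tensor_form_le:
  assumes "nonneg_tensor m A"
  shows "\<bar>tensor_form m A x\<bar> \<le> tensor_form m A (\<chi> i. \<bar>x $ i\<bar>)"
proof -
  have *: "\<bar>\<Prod>j\<leftarrow>js. x $ j\<bar> = (\<Prod>j\<leftarrow>js. (\<chi> i. \<bar>x $ i\<bar>) $ j)" for js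
    by (induction js) (auto simp: abs_mult)
  have "\<bar>A js * (\<Prod>j\<leftarrow>js. x $ j)\<bar> = A js * (\<Prod>j\<leftarrow>js. (\<chi> i. \<bar>x $ i\<bar>) $ j)"
    if "js \<in> index_tuples m" for js
    unfolding abs_mult * using assms that by (simp del: vec_lambda_beta add: nonneg_tensor_def)
  then show ?thesis unfolding tensor_form_def
    by (intro order_trans[OF sum_abs] sum_mono eq_refl)
qed

lemma norm_vec_abs: "norm (\<chi> i. \<bar>x $ i\<bar>) = norm (x :: real ^ 'n)"
  by (simp add: norm_vec_def)

section \<open>A nonnegative eigenvector with dominant eigenvalue\<close>

text \<open>A Lagrange multiplier argument made unconstrained: the form and
  \<open>\<rho> * norm z ^ m\<close> are both homogeneous of degree \<open>m\<close>, so their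
  difference \<open>g\<close> is at most 0 everywhere and vanishes at \<open>y\<close>. Its gradient
  at \<open>y\<close> is therefore zero.\<close>

lemma maximizer_is_eigenvector:
  fixes A :: "'n::finite tensor"
  assumes "m > 0" and sym: "weakly_symmetric m A" and y: "norm y = 1"
    and max: "\<And>x. norm x = 1 \<Longrightarrow> tensor_form m A x \<le> tensor_form m A y"
  shows "tensor_apply m A y = tensor_form m A y *\<^sub>R y"
proof -
  define \<rho> where "\<rho> = tensor_form m A y"
  define g where "g = (\<lambda>z. tensor_form m A z - \<rho> * norm z ^ m)"
  have le: "g z \<le> g y" for z
  proof -
    have "tensor_form m A z \<le> \<rho> * norm z ^ m"
    proof (cases "z = 0")
      case True
      then show ?thesis using tensor_form_scaleR[of m A 0 0] \<open>m > 0\<close> by (simp add: zero_power)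
    next
      case False
      have "tensor_form m A z = norm z ^ m * tensor_form m A (z /\<^sub>R norm z)"
        using False tensor_form_scaleR[of m A "norm z" "z /\<^sub>R norm z"] by simp
      also have "\<dots> \<le> norm z ^ m * \<rho>"
        unfolding \<rho>_def using False by (intro mult_left_mono max) auto
      finally show ?thesis by (simp add: mult.commute)
    qed
    then show ?thesis by (simp add: g_def y \<rho>_def)
  qed
  have "y \<noteq> 0" using y by auto
  have f': "(tensor_form m A has_derivative (\<lambda>h. h \<bullet> (real m *\<^sub>R tensor_apply m A y))) (at y)"
    using sym by (simp add: weakly_symmetric_def gderiv_def)
  \<comment> \<open>The gradient of the norm is \<open>sgn y\<close>, which is \<open>y\<close>
    itself on the unit sphere.\<close>
  have n': "(norm has_derivative (\<lambda>h. h \<bullet> y)) (at y)"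
    using GDERIV_norm[OF \<open>y \<noteq> 0\<close>] y by (simp add: gderiv_def sgn_div_norm)
  let ?D = "real m *\<^sub>R (tensor_apply m A y - \<rho> *\<^sub>R y)"
  have "(g has_derivative (\<lambda>h. h \<bullet> ?D)) (at y)"
    unfolding g_def
    by (rule has_derivative_eq_rhs[OF has_derivative_diff[OF f'
          has_derivative_mult_right[OF has_derivative_power[OF n']]]])
      (auto simp: y inner_diff_right algebra_simps)
  then have "(\<lambda>h. h \<bullet> ?D) = (\<lambda>h. 0)"
    using differential_zero_maxmin[of y UNIV g "\<lambda>h. h \<bullet> ?D"] le by auto
  then have "?D \<bullet> ?D = 0" by metis
  then show ?thesis using \<open>m > 0\<close> by (simp add: \<rho>_def)
qed

lemma nonneg_dominant_eigenvector:
  fixes A :: "'n::finite tensor"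
  assumes "m > 0" and sym: "weakly_symmetric m A" and nonneg: "nonneg_tensor m A"
  obtains y \<rho> where "norm y = 1" "\<And>i. y $ i \<ge> 0" "tensor_apply m A y = \<rho> *\<^sub>R y"
    "\<And>\<mu>. \<mu> \<in> Z_spectrum m A \<Longrightarrow> \<bar>\<mu>\<bar> \<le> \<rho>"
proof -
  \<comment> \<open>Weak symmetry supplies a gradient everywhere, hence continuity.\<close>
  have "continuous_on (sphere 0 1) (tensor_form m A)"
    using sym unfolding weakly_symmetric_def gderiv_def
    by (meson has_derivative_continuous continuous_at_imp_continuous_on)
  moreover have "sphere (0 :: real ^ 'n) 1 \<noteq> {}" by simp
  ultimately obtain x where x: "norm x = 1"
    and max: "\<And>z. norm z = 1 \<Longrightarrow> tensor_form m A z \<le> tensor_form m A x"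
    using continuous_attains_sup[OF compact_sphere] by (metis mem_sphere_0)
  define y where "y = (\<chi> i. \<bar>x $ i\<bar>)"
  have y: "norm y = 1" using x by (simp add: y_def norm_vec_abs)
  have maxy: "tensor_form m A z \<le> tensor_form m A y" if "norm z = 1" for z
    using max[OF that] abs_tensor_form_le[OF nonneg, of x] by (simp add: y_def)
  show ?thesis
  proof (rule that[OF y])
    show "tensor_apply m A y = tensor_form m A y *\<^sub>R y"
      by (rule maximizer_is_eigenvector[OF assms(1) sym y maxy])
    fix \<mu> assume "\<mu> \<in> Z_spectrum m A"
    then obtain v where v: "tensor_apply m A v = \<mu> *\<^sub>R v" "v \<bullet> v = 1"
      by (auto simp: Z_spectrum_def Z_eigenvalue_def)
    then have "\<mu> = tensor_form m A v"
      using inner_tensor_apply[OF \<open>m > 0\<close>, of v A] by simp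
    then have "\<bar>\<mu>\<bar> \<le> tensor_form m A (\<chi> i. \<bar>v $ i\<bar>)"
      using abs_tensor_form_le[OF nonneg] by simp
    also have "\<dots> \<le> tensor_form m A y"
      using v by (intro maxy) (simp add: norm_vec_abs norm_eq_1)
    finally show "\<bar>\<mu>\<bar> \<le> tensor_form m A y" .
  qed (simp add: y_def)
qed

section \<open>Row-sum estimates and the quadratic bound\<close>

lemma prod_list_le_member:
  fixes f :: "'a \<Rightarrow> real"
  assumes "\<And>i. 0 \<le> f i" "\<And>i. f i \<le> 1" "j \<in> set js"
  shows "(\<Prod>i\<leftarrow>js. f i) \<le> f j"
proof -
  have bounds: "0 \<le> (\<Prod>i\<leftarrow>ks. f i) \<and> (\<Prod>i\<leftarrow>ks. f i) \<le> 1" for ks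
    by (induction ks) (auto intro: mult_le_one mult_nonneg_nonneg assms(1,2))
  show ?thesis using assms(3)
  proof (induction js)
    case (Cons a js)
    show ?case
    proof (cases "j = a")
      case True
      then show ?thesis using bounds[of js] assms(1)[of a] by (simp add: mult_left_le)
    next
      case False
      with Cons have "(\<Prod>i\<leftarrow>js. f i) \<le> f j" by auto
      moreover have "f a * (\<Prod>i\<leftarrow>js. f i) \<le> (\<Prod>i\<leftarrow>js. f i)"
        using bounds[of js] assms by (intro mult_left_le_one_le) auto
      ultimately show ?thesis by simp
    qed
  qed simp
qed

lemma row_sum_split: "row_sum m A i = row_sum_out m A i j + row_sum_in m A i j"
proof -
  have "index_tuples (m - 1) =
      {js \<in> index_tuples (m - 1). j \<notin> set js} \<union> {js \<in> index_tuples (m - 1). j \<in> set js}" by auto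
  then show ?thesis unfolding row_sum_def row_sum_out_def row_sum_in_def
    by (metis (no_types, lifting) sum.union_disjoint finite_index_tuples finite_Un
        disjoint_iff mem_Collect_eq)
qed

lemma row_sum_in_nonneg: "0 \<le> row_sum_in m A i j"
  and row_sum_out_nonneg: "0 \<le> row_sum_out m A i j"
  by (auto simp: row_sum_in_def row_sum_out_def intro: sum_nonneg)

text \<open>Each monomial is bounded by one of its factors: \<open>y $ j\<close> if \<open>j\<close>
  occurs, otherwise any factor, which is at most \<open>y $ t\<close>.\<close>

lemma tensor_apply_le:
  fixes A :: "'n::finite tensor"
  assumes m: "m \<ge> 2" and y: "\<And>k. 0 \<le> y $ k" "\<And>k. y $ k \<le> 1" and t: "\<And>k. y $ k \<le> y $ t"
  shows "tensor_apply m A y $ i \<le> row_sum_out m A i j * y $ t + row_sum_in m A i j * y $ j"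
proof -
  let ?p = "\<lambda>js. \<Prod>k\<leftarrow>js. y $ k"
  let ?I = "index_tuples (m - 1) :: 'n list set"
  let ?O = "{js \<in> ?I. j \<notin> set js}" and ?J = "{js \<in> ?I. j \<in> set js}"
  have p0: "0 \<le> ?p js" for js by (induction js) (auto simp: y)
  have pt: "?p js \<le> y $ t" if "js \<in> ?I" for js
  proof -
    \<comment> \<open>Since \<open>m - 1 \<ge> 1\<close>, the tuple has an entry.\<close>
    from that m obtain k where "k \<in> set js" by (cases js) (auto simp: index_tuples_def)
    then show ?thesis using prod_list_le_member[of "($) y" k js] y t[of k] by auto
  qed
  have "tensor_apply m A y $ i \<le> (\<Sum>js\<in>?I. \<bar>A (i # js)\<bar> * ?p js)"
    by (auto simp: tensor_apply_def intro!: sum_mono mult_right_mono p0)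
  also have "\<dots> = (\<Sum>js\<in>?O \<union> ?J. \<bar>A (i # js)\<bar> * ?p js)"
    by (rule sum.cong) auto
  also have "\<dots> = (\<Sum>js\<in>?O. \<bar>A (i # js)\<bar> * ?p js) + (\<Sum>js\<in>?J. \<bar>A (i # js)\<bar> * ?p js)"
    by (rule sum.union_disjoint) auto
  also have "\<dots> \<le> (\<Sum>js\<in>?O. \<bar>A (i # js)\<bar> * y $ t) + (\<Sum>js\<in>?J. \<bar>A (i # js)\<bar> * y $ j)"
    by (intro add_mono sum_mono mult_left_mono)
      (auto intro: pt prod_list_le_member[of "($) y"] simp: y)
  finally show ?thesis
    by (simp add: row_sum_out_def row_sum_in_def sum_distrib_right)
qed

text \<open>The right-hand side is the larger root of \<open>(x - a) (x - d) = q\<close>.\<close>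

lemma le_larger_root:
  fixes a d q \<rho> :: real
  assumes "q \<ge> 0" and "\<rho> > a \<Longrightarrow> \<rho> > d \<Longrightarrow> (\<rho> - a) * (\<rho> - d) \<le> q"
  shows "\<rho> \<le> 1 / 2 * (a + d + sqrt ((a - d)\<^sup>2 + 4 * q))"
proof -
  have "2 * \<rho> - a - d \<le> sqrt ((a - d)\<^sup>2 + 4 * q)"
  proof (cases "\<rho> > a \<and> \<rho> > d")
    case True
    \<comment> \<open>The left side equals
      \<open>(a - d)\<^sup>2 + 4 * (\<rho> - a) * (\<rho> - d)\<close>.\<close>
    then have "(2 * \<rho> - a - d)\<^sup>2 \<le> (a - d)\<^sup>2 + 4 * q"
      using assms(2) by (simp add: power2_eq_square algebra_simps)
    then show ?thesis by (rule real_le_rsqrt)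
  next
    case False
    then have "2 * \<rho> - a - d \<le> \<bar>a - d\<bar>" by auto
    also have "\<dots> \<le> sqrt ((a - d)\<^sup>2 + 4 * q)"
      using \<open>q \<ge> 0\<close> by (intro real_le_rsqrt) simp
    finally show ?thesis .
  qed
  then show ?thesis by simp
qed

lemma eigenvalue_le_Omega_tilde_max:
  fixes A :: "'n::finite tensor"
  assumes n: "CARD('n) \<ge> 2" and m: "m \<ge> 2"
    and y: "norm y = 1" "\<And>i. y $ i \<ge> 0" and eig: "tensor_apply m A y = \<rho> *\<^sub>R y"
  shows "\<rho> \<le> Omega_tilde_max m A"
proof -
  have y1: "y $ k \<le> 1" for k using component_le_norm_cart[of y k] y(1) by simp
  have "Max (range (($) y)) \<in> range (($) y)" by (rule Max_in) auto
  then obtain t where "y $ t = Max (range (($) y))" by (metis imageE)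
  then have t: "y $ k \<le> y $ t" for k by simp
  have t0: "y $ t > 0"
  proof (rule ccontr)
    assume "\<not> y $ t > 0"
    then have "y $ k = 0" for k using t[of k] y(2)[of k] by linarith
    then have "y = 0" by (simp add: vec_eq_iff)
    with y(1) show False by simp
  qed
  have eq: "\<rho> * y $ i \<le> row_sum_out m A i j * y $ t + row_sum_in m A i j * y $ j" for i j
    using tensor_apply_le[OF m y(2) y1 t, of A i j] eig by simp
  have row: "\<rho> \<le> row_sum m A t"
  proof -
    have "\<rho> * y $ t \<le> row_sum m A t * y $ t"
      \<comment> \<open>With \<open>j = t\<close> both terms are multiples of \<open>y $ t\<close>,
        and their coefficients add up to the full row sum.\<close>
      using eq[of t t] by (simp add: row_sum_split[of m A t t] algebra_simps)
    then show ?thesis using t0 by simp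
  qed
  have bar: "\<rho> \<le> Omega_bar m A t j" for j
  proof -
    let ?a = "row_sum_out m A t j" and ?b = "row_sum_in m A t j"
    let ?c = "row_sum_out m A j j" and ?d = "row_sum_in m A j j"
    have "(\<rho> - ?a) * (\<rho> - ?d) \<le> ?b * ?c" if "\<rho> > ?a" "\<rho> > ?d"
    proof -
      have 1: "(\<rho> - ?a) * y $ t \<le> ?b * y $ j" and 2: "(\<rho> - ?d) * y $ j \<le> ?c * y $ t"
        using eq[of t j] eq[of j j] by (simp_all add: algebra_simps)
      \<comment> \<open>Otherwise the positive number \<open>(\<rho> - ?a) * y $ t\<close> would be
        at most 0.\<close>
      have "y $ j \<noteq> 0"
        using 1 that(1) t0 by (auto simp: mult_le_0_iff)
      then have j0: "y $ j > 0" using y(2)[of j] by simp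
      \<comment> \<open>Multiplying the two inequalities leaves the common positive factor
        \<open>y $ t * y $ j\<close> to cancel.\<close>
      have "((\<rho> - ?a) * y $ t) * ((\<rho> - ?d) * y $ j) \<le> (?b * y $ j) * (?c * y $ t)"
        using that t0 j0 by (intro mult_mono 1 2) (auto simp: row_sum_in_nonneg)
      then have "((\<rho> - ?a) * (\<rho> - ?d)) * (y $ t * y $ j) \<le> (?b * ?c) * (y $ t * y $ j)"
        by (simp add: mult_ac)
      then show ?thesis using t0 j0 by simp
    qed
    then show ?thesis
      using le_larger_root[of "?b * ?c" ?a \<rho> ?d]
      by (simp add: Omega_bar_def row_sum_in_nonneg row_sum_out_nonneg mult.assoc)
  qed
  have "UNIV - {t} \<noteq> {}"
  proof
    assume "UNIV - {t} = {}"
    then have "UNIV = {t}" by auto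
    then have "CARD('n) = card {t}" by simp
    with n show False by simp
  qed
  \<comment> \<open>Both bounds hold at the fixed row \<open>t\<close> for every \<open>j\<close>,
    so they pass to the inner minimum; the outer maximum needs only this row.\<close>
  then have "\<rho> \<le> (MIN j\<in>UNIV - {t}. min (row_sum m A t) (Omega_bar m A t j))"
    using row bar by (subst Min_ge_iff) auto
  also have "\<dots> \<le> Omega_tilde_max m A"
    unfolding Omega_tilde_max_def by (rule Max_ge) auto
  finally show ?thesis .
qed

theorem theorem6:
  fixes A :: "'n::finite tensor" and m :: nat
  assumes "CARD('n) \<ge> 2"
    and "m \<ge> 2"
    and "weakly_symmetric m A"
    and "nonneg_tensor m A"
  shows "Z_spectral_radius m A \<le> Omega_max m A"
proof -
  have "m > 0" using assms(2) by simp
  then obtain y \<rho> where y: "norm y = 1" "\<And>i. y $ i \<ge> 0"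
    and eig: "tensor_apply m A y = \<rho> *\<^sub>R y"
    and dom: "\<And>\<mu>. \<mu> \<in> Z_spectrum m A \<Longrightarrow> \<bar>\<mu>\<bar> \<le> \<rho>"
    using nonneg_dominant_eigenvector[OF _ assms(3,4)] by metis
  \<comment> \<open>Membership shows that the spectrum is nonempty, so its supremum is bounded by
    any upper bound.\<close>
  have "\<rho> \<in> Z_spectrum m A"
    using y eig by (auto simp: Z_spectrum_def Z_eigenvalue_def norm_eq_1 intro!: exI[of _ y])
  then have "Z_spectral_radius m A \<le> \<rho>"
    unfolding Z_spectral_radius_def by (intro cSUP_least dom) auto
  also have "\<rho> \<le> Omega_tilde_max m A"
    by (rule eigenvalue_le_Omega_tilde_max[OF assms(1,2) y eig])
  finally show ?thesis by (simp add: Omega_max_def)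
qed

end
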